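(* Let $\mathcal{A}$ be a submonoid of the monoid of endorelations on a set $A$ (under relational composition, with unit $1_A$). Then assigning to every relation $r\subseteq X\times Y$ the relation $\widehat{H}_A^{\mathcal{A}} r\subseteq X^A\times Y^A$ defined by $f\,(\widehat{H}_A^{\mathcal{A}}r)\,g$ iff there is $\phi\in\mathcal{A}$ with $\phi\le g^\circ\cdot r\cdot f$ defines a lax extension of $H_A=(-)^A$. Furthermore, (1) if $\mathcal{A}$ is closed under converses, then $\widehat{H}_A^{\mathcal{A}}$ preserves converses, and (2) if every relation in $\mathcal{A}$ is normal, then $\widehat{H}_A^{\mathcal{A}}$ is normal.
   Context: Relations $r\subseteq X\times Y$ are composed applicatively, $r^\circ$ is the converse, functions are regarded as relations, $1_X$ is the identity. $H_A\colon\mathbf{Set}\to\mathbf{Set}$ is the exponential functor $X\mapsto X^A$. Pointwise, $\phi\le g^\circ\cdot r\cdot f$ means $a\,\phi\,b\Rightarrow f(a)\,r\,g(b)$. A lax extension of a functor $F$ is a monotone assignment of $Lr\subseteq FX\times FY$ to each $r\subseteq X\times Y$ with $Ff\le Lf$, $(Ff)^\circ\le L(f^\circ)$ for all functions $f$ and $Ls\cdot Lr\le L(s\cdot r)$; it is normal if $L1_X=1_{FX}$ and preserves converses if $L(r^\circ)=(Lr)^\circ$. An endorelation $\phi\subseteq A\times A$ is normal if its difunctional closure (least relation of the form $g^\circ\cdot f$ containing it) is reflexive. *)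

theory Defs
  imports "HOL-Algebra.Group"
begin

text \<open>
  A set is a carrier set over a HOL type, so that empty sets are included; morphisms
  \<open>X \<rightarrow> Y\<close> are the extensional functions in \<open>X \<rightarrow>\<^sub>E Y\<close>, and the function \<open>f\<close> with domain \<open>X\<close>,
  regarded as a relation, is \<open>graph X f\<close>.
  Quantification over all sets becomes quantification over all subsets of an
  arbitrary type \<open>'u\<close>. No condition below involves more than three sets at a time, and
  any three sets embed into a common type, so using a single \<open>'u\<close> is no restriction.
\<close>

abbreviation app_comp :: "('y \<times> 'z) set \<Rightarrow> ('x \<times> 'y) set \<Rightarrow> ('x \<times> 'z) set"  (infixr \<open>\<cdot>\<close> 75)
  where "s \<cdot> r \<equiv> r O s"

abbreviation graph :: "'x set \<Rightarrow> ('x \<Rightarrow> 'y) \<Rightarrow> ('x \<times> 'y) set"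
  where "graph \<equiv> BNF_Def.Gr"


section \<open>Set functors and lax extensions\<close>

locale set_functor =
  fixes Ob :: "'u set \<Rightarrow> 'v set"
    and Mor :: "'u set \<Rightarrow> 'u set \<Rightarrow> ('u \<Rightarrow> 'u) \<Rightarrow> 'v \<Rightarrow> 'v"
  assumes Mor_closed: "f \<in> X \<rightarrow>\<^sub>E Y \<Longrightarrow> Mor X Y f \<in> Ob X \<rightarrow>\<^sub>E Ob Y"
    and Mor_id: "Mor X X (\<lambda>x\<in>X. x) = (\<lambda>x\<in>Ob X. x)"
    and Mor_comp: "f \<in> X \<rightarrow>\<^sub>E Y \<Longrightarrow> g \<in> Y \<rightarrow>\<^sub>E Z \<Longrightarrow>
      Mor X Z (compose X g f) = compose (Ob X) (Mor Y Z g) (Mor X Y f)"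

text \<open>
  A relation does not determine its domain and codomain, so \<open>L\<close> takes them as arguments;
  the values of \<open>L X Y\<close> outside the subsets of \<open>X \<times> Y\<close> are irrelevant.
\<close>

locale lax_extension = set_functor Ob Mor
  for Ob :: "'u set \<Rightarrow> 'v set"
    and Mor :: "'u set \<Rightarrow> 'u set \<Rightarrow> ('u \<Rightarrow> 'u) \<Rightarrow> 'v \<Rightarrow> 'v" +
  fixes L :: "'u set \<Rightarrow> 'u set \<Rightarrow> ('u \<times> 'u) set \<Rightarrow> ('v \<times> 'v) set"
  assumes lax_closed: "r \<subseteq> X \<times> Y \<Longrightarrow> L X Y r \<subseteq> Ob X \<times> Ob Y"
    and lax_mono: "r \<subseteq> s \<Longrightarrow> s \<subseteq> X \<times> Y \<Longrightarrow> L X Y r \<subseteq> L X Y s"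
    and lax_fun: "f \<in> X \<rightarrow>\<^sub>E Y \<Longrightarrow> graph (Ob X) (Mor X Y f) \<subseteq> L X Y (graph X f)"
    and lax_fun_converse: "f \<in> X \<rightarrow>\<^sub>E Y \<Longrightarrow> (graph (Ob X) (Mor X Y f))\<inverse> \<subseteq> L Y X ((graph X f)\<inverse>)"
    and lax_comp: "r \<subseteq> X \<times> Y \<Longrightarrow> s \<subseteq> Y \<times> Z \<Longrightarrow> L Y Z s \<cdot> L X Y r \<subseteq> L X Z (s \<cdot> r)"

definition normal_ext ::
    "('u set \<Rightarrow> 'v set) \<Rightarrow> ('u set \<Rightarrow> 'u set \<Rightarrow> ('u \<times> 'u) set \<Rightarrow> ('v \<times> 'v) set) \<Rightarrow> bool"
  where "normal_ext Ob L \<longleftrightarrow> (\<forall>X. L X X (Id_on X) = Id_on (Ob X))"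

definition preserves_converses ::
    "('u set \<Rightarrow> 'u set \<Rightarrow> ('u \<times> 'u) set \<Rightarrow> ('v \<times> 'v) set) \<Rightarrow> bool"
  where "preserves_converses L \<longleftrightarrow> (\<forall>X Y r. r \<subseteq> X \<times> Y \<longrightarrow> L Y X (r\<inverse>) = (L X Y r)\<inverse>)"


section \<open>The exponential functor and its relational extension\<close>

definition exp_ob :: "'a set \<Rightarrow> 'u set \<Rightarrow> ('a \<Rightarrow> 'u) set"
  where "exp_ob A X = A \<rightarrow>\<^sub>E X"

definition exp_mor ::
    "'a set \<Rightarrow> 'u set \<Rightarrow> 'u set \<Rightarrow> ('u \<Rightarrow> 'u) \<Rightarrow> ('a \<Rightarrow> 'u) \<Rightarrow> ('a \<Rightarrow> 'u)"
  where "exp_mor A X Y f = (\<lambda>h\<in>exp_ob A X. compose A f h)"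

definition exp_ext ::
    "'a set \<Rightarrow> ('a \<times> 'a) set set \<Rightarrow>
     'u set \<Rightarrow> 'u set \<Rightarrow> ('u \<times> 'u) set \<Rightarrow> (('a \<Rightarrow> 'u) \<times> ('a \<Rightarrow> 'u)) set"
  where "exp_ext A \<A> X Y r =
    {(f, g). f \<in> exp_ob A X \<and> g \<in> exp_ob A Y \<and>
             (\<exists>\<phi>\<in>\<A>. \<phi> \<subseteq> (graph A g)\<inverse> \<cdot> r \<cdot> graph A f)}"


section \<open>Endorelations\<close>

definition endorel_monoid :: "'a set \<Rightarrow> ('a \<times> 'a) set monoid"
  where "endorel_monoid A =
    \<lparr>carrier = Pow (A \<times> A), mult = (\<lambda>s r. s \<cdot> r), one = Id_on A\<rparr>"

lemma monoid_endorel_monoid: "monoid (endorel_monoid A)"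
  by (rule monoidI) (auto simp: endorel_monoid_def)

text \<open>
  The intermediate set \<open>Z\<close> ranges over the subsets of the fixed type \<open>'a + 'b\<close>, which is
  large enough: see \<open>difunctionalI\<close>, where the common codomain is an arbitrary type.
\<close>

definition difunctional :: "'a set \<Rightarrow> 'b set \<Rightarrow> ('a \<times> 'b) set \<Rightarrow> bool"
  where "difunctional X Y r \<longleftrightarrow>
    (\<exists>(Z :: ('a + 'b) set) f g. f \<in> X \<rightarrow> Z \<and> g \<in> Y \<rightarrow> Z \<and> r = (graph Y g)\<inverse> \<cdot> graph X f)"

definition difunctional_closure :: "'a set \<Rightarrow> 'b set \<Rightarrow> ('a \<times> 'b) set \<Rightarrow> ('a \<times> 'b) set"
  where "difunctional_closure X Y r = (LEAST d. difunctional X Y d \<and> r \<subseteq> d)"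

definition normal_endorel :: "'a set \<Rightarrow> ('a \<times> 'a) set \<Rightarrow> bool"
  where "normal_endorel A \<phi> \<longleftrightarrow> refl_on A (difunctional_closure A A \<phi>)"

lemma mem_graph_converse_comp:
  "(x, y) \<in> (graph Y g)\<inverse> \<cdot> graph X f \<longleftrightarrow> x \<in> X \<and> y \<in> Y \<and> f x = g y"
  by (auto simp: BNF_Def.Gr_def)

lemma difunctionalI:
  fixes f :: "'a \<Rightarrow> 'z" and g :: "'b \<Rightarrow> 'z"
  shows "difunctional X Y ((graph Y g)\<inverse> \<cdot> graph X f)"
proof -
  define h :: "'z \<Rightarrow> 'a + 'b" where
    "h z = (if z \<in> f ` X then Inl (inv_into X f z) else Inr (inv_into Y g z))" for z
  have "inj_on h (f ` X \<union> g ` Y)"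
    by (auto simp: inj_on_def h_def split: if_splits intro: inv_into_injective)
  then have "h (f x) = h (g y) \<longleftrightarrow> f x = g y" if "x \<in> X" "y \<in> Y" for x y
    using that by (simp add: inj_on_eq_iff)
  then have "(graph Y g)\<inverse> \<cdot> graph X f = (graph Y (h \<circ> g))\<inverse> \<cdot> graph X (h \<circ> f)"
    by (intro equalityI subrelI) (auto simp only: mem_graph_converse_comp o_apply)
  then show ?thesis
    unfolding difunctional_def by (intro exI[of _ UNIV] exI) auto
qed

lemma difunctional_iff:
  "difunctional X Y r \<longleftrightarrow> r \<subseteq> X \<times> Y \<and> r \<cdot> r\<inverse> \<cdot> r \<subseteq> r"
proof
  assume "difunctional X Y r"
  then show "r \<subseteq> X \<times> Y \<and> r \<cdot> r\<inverse> \<cdot> r \<subseteq> r"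
    by (auto simp: difunctional_def BNF_Def.Gr_def)
next
  assume r: "r \<subseteq> X \<times> Y \<and> r \<cdot> r\<inverse> \<cdot> r \<subseteq> r"
  define f where "f x = Some (r `` {x})" for x
  define g where "g y = (if y \<in> Range r then Some (r `` (r\<inverse> `` {y})) else None)" for y
  have *: "f x = g y \<longleftrightarrow> (x, y) \<in> r" for x y
  proof
    assume "f x = g y"
    then show "(x, y) \<in> r"
      by (auto simp: f_def g_def split: if_splits)
  next
    assume xy: "(x, y) \<in> r"
    then have "r `` {x} = r `` (r\<inverse> `` {y})"
      using r by blast
    then show "f x = g y"
      using xy by (auto simp: f_def g_def)
  qed
  have "r = (graph Y g)\<inverse> \<cdot> graph X f"
  proof -
    have "(x, y) \<in> r \<longleftrightarrow> (x, y) \<in> (graph Y g)\<inverse> \<cdot> graph X f" for x y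
      using r *[of x y] by (auto simp: mem_graph_converse_comp)
    then show ?thesis by (intro equalityI subrelI) simp_all
  qed
  then show "difunctional X Y r"
    using difunctionalI[where f = f and g = g and X = X and Y = Y] by simp
qed

lemma difunctional_closure_least:
  assumes "r \<subseteq> X \<times> Y"
  shows "difunctional X Y (difunctional_closure X Y r)"
    and "r \<subseteq> difunctional_closure X Y r"
    and "difunctional X Y d \<Longrightarrow> r \<subseteq> d \<Longrightarrow> difunctional_closure X Y r \<subseteq> d"
proof -
  let ?I = "\<Inter>{d. difunctional X Y d \<and> r \<subseteq> d}"
  have "difunctional X Y (X \<times> Y)"
    by (auto simp: difunctional_iff)
  then have "?I \<subseteq> X \<times> Y"
    using assms by blast
  moreover have "?I \<cdot> ?I\<inverse> \<cdot> ?I \<subseteq> ?I"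
  proof (rule Inter_greatest)
    fix d assume d: "d \<in> {d. difunctional X Y d \<and> r \<subseteq> d}"
    then have "?I \<subseteq> d" by blast
    then have "?I \<cdot> ?I\<inverse> \<cdot> ?I \<subseteq> d \<cdot> d\<inverse> \<cdot> d"
      by (intro relcomp_mono) auto
    also have "\<dots> \<subseteq> d"
      using d by (simp add: difunctional_iff)
    finally show "?I \<cdot> ?I\<inverse> \<cdot> ?I \<subseteq> d" .
  qed
  ultimately have I: "difunctional X Y ?I"
    by (simp add: difunctional_iff)
  have eq: "difunctional_closure X Y r = ?I"
    unfolding difunctional_closure_def
    by (rule Least_equality) (use I in auto)
  show "difunctional X Y (difunctional_closure X Y r)"
    using I eq by simp
  show "r \<subseteq> difunctional_closure X Y r"
    using eq by auto
  show "difunctional X Y d \<Longrightarrow> r \<subseteq> d \<Longrightarrow> difunctional_closure X Y r \<subseteq> d"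
    using eq by auto
qed

end

theory Submission
  imports Defs
begin

text \<open>By \<open>mem_exp_ext\<close>, \<open>f\<close> and \<open>g\<close> are related as soon
  as some witness \<phi> in \<A> satisfies: \<open>(a, b)\<close> in \<phi> implies
  \<open>(f a, g b)\<close> in \<open>r\<close>. Each claim then becomes a closure property of the
  set of witnesses. Monotonicity keeps the witness; the two conditions on functions take the unit
  \<open>Id_on A\<close>; lax functoriality composes witnesses; preservation of converses takes the
  converse witness.

  Normality is the one claim that needs more. For the identity relation the bound on \<phi> is the
  difunctional relation of all \<open>(a, b)\<close> with \<open>f a = g b\<close>. It therefore
  contains the difunctional closure of \<phi>, and reflexivity of that closure forces
  \<open>f a = g a\<close> for every \<open>a\<close> in \<open>A\<close>.\<close>

lemma mem_exp_ext:
  assumes "\<A> \<subseteq> Pow (A \<times> A)"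
  shows "(f, g) \<in> exp_ext A \<A> X Y r \<longleftrightarrow>
    f \<in> A \<rightarrow>\<^sub>E X \<and> g \<in> A \<rightarrow>\<^sub>E Y \<and> (\<exists>\<phi>\<in>\<A>. \<forall>(a, b)\<in>\<phi>. (f a, g b) \<in> r)"
proof -
  have "\<phi> \<subseteq> (graph A g)\<inverse> \<cdot> r \<cdot> graph A f \<longleftrightarrow> (\<forall>(a, b)\<in>\<phi>. (f a, g b) \<in> r)"
    if "\<phi> \<in> \<A>" for \<phi>
  proof -
    have *: "(a, b) \<in> (graph A g)\<inverse> \<cdot> r \<cdot> graph A f \<longleftrightarrow> a \<in> A \<and> b \<in> A \<and> (f a, g b) \<in> r" for a b
      by (auto simp: BNF_Def.Gr_def)
    \<comment> \<open>Witnesses live on \<open>A\<close>, so the domain conditions coming from the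
      graphs are automatic.\<close>
    have "a \<in> A \<and> b \<in> A" if "(a, b) \<in> \<phi>" for a b
      using that \<open>\<phi> \<in> \<A>\<close> assms by blast
    then show ?thesis
      unfolding subset_iff split_paired_All Ball_def split_conv * by blast
  qed
  then show ?thesis
    by (auto simp: exp_ext_def exp_ob_def)
qed

text \<open>Postcomposition is functorial because composition is associative and unital. The
  restrictions in \<open>compose\<close> are harmless: maps in \<open>exp_ob A X\<close> are
  extensional and take values in \<open>X\<close> on all of \<open>A\<close>.\<close>

lemma set_functor_exp: "set_functor (exp_ob A) (exp_mor A)"
proof
  fix f :: "'u \<Rightarrow> 'u" and X Y :: "'u set"
  assume "f \<in> X \<rightarrow>\<^sub>E Y"
  then show "exp_mor A X Y f \<in> exp_ob A X \<rightarrow>\<^sub>E exp_ob A Y"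
    by (auto simp: exp_mor_def exp_ob_def compose_def)
next
  fix X :: "'u set"
  show "exp_mor A X X (\<lambda>x\<in>X. x) = (\<lambda>x\<in>exp_ob A X. x)"
    unfolding exp_mor_def
    by (rule restrict_ext) (auto simp: exp_ob_def compose_def fun_eq_iff PiE_iff extensional_def)
next
  fix f g :: "'u \<Rightarrow> 'u" and X Y Z :: "'u set"
  assume "f \<in> X \<rightarrow>\<^sub>E Y" "g \<in> Y \<rightarrow>\<^sub>E Z"
  then show "exp_mor A X Z (compose X g f) =
      compose (exp_ob A X) (exp_mor A Y Z g) (exp_mor A X Y f)"
    by (auto simp: exp_mor_def exp_ob_def compose_def fun_eq_iff PiE_iff)
qed

lemma lax_extension_exp_ext:
  assumes "submonoid \<A> (endorel_monoid A)"
  shows "lax_extension (exp_ob A) (exp_mor A) (exp_ext A \<A>)"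
proof -
  have sub: "\<A> \<subseteq> Pow (A \<times> A)"
    and unit: "Id_on A \<in> \<A>"
    and mult: "\<And>\<phi> \<psi>. \<phi> \<in> \<A> \<Longrightarrow> \<psi> \<in> \<A> \<Longrightarrow> \<phi> O \<psi> \<in> \<A>"
    using assms by (auto simp: submonoid_def endorel_monoid_def)
  note mem = mem_exp_ext[OF sub]
  \<comment> \<open>Pointwise related maps are related by the extension, with the unit as witness.
    Both conditions on functions are instances, since \<open>f\<close> sends \<open>h a\<close> to
    \<open>compose A f h a\<close>.\<close>
  have refl: "(h, k) \<in> exp_ext A \<A> X Y r"
    if "h \<in> A \<rightarrow>\<^sub>E X" "k \<in> A \<rightarrow>\<^sub>E Y" "\<And>a. a \<in> A \<Longrightarrow> (h a, k a) \<in> r"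
    for h k and X Y :: "'b set" and r
    using that unit by (auto simp: mem intro!: bexI[of _ "Id_on A"])
  interpret set_functor "exp_ob A" "exp_mor A"
    by (rule set_functor_exp)
  show ?thesis
  proof
    fix X Y :: "'b set" and r
    show "exp_ext A \<A> X Y r \<subseteq> exp_ob A X \<times> exp_ob A Y"
      by (auto simp: exp_ext_def)
  next
    fix X Y :: "'b set" and r s :: "('b \<times> 'b) set"
    assume "r \<subseteq> s"
    then have "(f, g) \<in> exp_ext A \<A> X Y s" if "(f, g) \<in> exp_ext A \<A> X Y r" for f g
      using that unfolding mem by (elim conjE bexE, intro conjI bexI) auto
    then show "exp_ext A \<A> X Y r \<subseteq> exp_ext A \<A> X Y s"
      by (rule subrelI)
  next
    fix X Y :: "'b set" and f
    assume f: "f \<in> X \<rightarrow>\<^sub>E Y"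
    show "graph (exp_ob A X) (exp_mor A X Y f) \<subseteq> exp_ext A \<A> X Y (graph X f)"
    proof (intro subrelI)
      fix h k assume "(h, k) \<in> graph (exp_ob A X) (exp_mor A X Y f)"
      then have h: "h \<in> A \<rightarrow>\<^sub>E X" and k: "k = compose A f h"
        by (simp_all add: BNF_Def.Gr_def exp_mor_def exp_ob_def)
      show "(h, k) \<in> exp_ext A \<A> X Y (graph X f)"
        by (rule refl) (use f h k in \<open>auto simp: BNF_Def.Gr_def compose_def\<close>)
    qed
  next
    fix X Y :: "'b set" and f
    assume f: "f \<in> X \<rightarrow>\<^sub>E Y"
    show "(graph (exp_ob A X) (exp_mor A X Y f))\<inverse> \<subseteq> exp_ext A \<A> Y X ((graph X f)\<inverse>)"
    proof (intro subrelI)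
      fix k h assume "(k, h) \<in> (graph (exp_ob A X) (exp_mor A X Y f))\<inverse>"
      then have h: "h \<in> A \<rightarrow>\<^sub>E X" and k: "k = compose A f h"
        by (simp_all add: BNF_Def.Gr_def exp_mor_def exp_ob_def)
      show "(k, h) \<in> exp_ext A \<A> Y X ((graph X f)\<inverse>)"
        by (rule refl) (use f h k in \<open>auto simp: BNF_Def.Gr_def compose_def\<close>)
    qed
  next
    fix X Y Z :: "'b set" and r s
    show "exp_ext A \<A> Y Z s \<cdot> exp_ext A \<A> X Y r \<subseteq> exp_ext A \<A> X Z (s \<cdot> r)"
    proof
      fix p assume "p \<in> exp_ext A \<A> Y Z s \<cdot> exp_ext A \<A> X Y r"
      then obtain f g h \<phi> \<psi> where p: "p = (f, h)" "f \<in> A \<rightarrow>\<^sub>E X" "h \<in> A \<rightarrow>\<^sub>E Z"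
        and \<phi>: "\<phi> \<in> \<A>" "\<forall>(a, b)\<in>\<phi>. (f a, g b) \<in> r"
        and \<psi>: "\<psi> \<in> \<A>" "\<forall>(a, b)\<in>\<psi>. (g a, h b) \<in> s"
        by (auto simp: mem)
      \<comment> \<open>If \<phi> relates \<open>a\<close> to \<open>c\<close> and \<psi> relates
        \<open>c\<close> to \<open>b\<close>, then \<open>g c\<close> is the intermediate point
        between \<open>f a\<close> and \<open>h b\<close>.\<close>
      have "\<forall>(a, b)\<in>\<phi> O \<psi>. (f a, h b) \<in> s \<cdot> r"
        using \<phi>(2) \<psi>(2) by fast
      then show "p \<in> exp_ext A \<A> X Z (s \<cdot> r)"
        using p mult[OF \<phi>(1) \<psi>(1)] by (auto simp: mem)
    qed
  qed
qed

lemma preserves_converses_exp_ext: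
  assumes sub: "\<A> \<subseteq> Pow (A \<times> A)" and conv: "\<And>\<phi>. \<phi> \<in> \<A> \<Longrightarrow> \<phi>\<inverse> \<in> \<A>"
  shows "preserves_converses (exp_ext A \<A>)"
proof -
  \<comment> \<open>One inclusion suffices: the other is this one applied to the converse of
    \<open>r\<close>, as taking converses is an involution.\<close>
  have swap: "(g, f) \<in> exp_ext A \<A> Y X (r\<inverse>)" if "(f, g) \<in> exp_ext A \<A> X Y r"
    for f g and X Y :: "'b set" and r
  proof -
    from that obtain \<phi> where "\<phi> \<in> \<A>" "\<forall>(a, b)\<in>\<phi>. (f a, g b) \<in> r"
      and "f \<in> A \<rightarrow>\<^sub>E X" "g \<in> A \<rightarrow>\<^sub>E Y"
      by (auto simp: mem_exp_ext[OF sub])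
    then show ?thesis
      using conv by (auto simp: mem_exp_ext[OF sub] intro!: bexI[of _ "\<phi>\<inverse>"])
  qed
  show ?thesis
    unfolding preserves_converses_def
  proof (intro allI impI equalityI subrelI)
    fix X Y :: "'b set" and r g f
    assume "(g, f) \<in> exp_ext A \<A> Y X (r\<inverse>)"
    from swap[OF this] show "(g, f) \<in> (exp_ext A \<A> X Y r)\<inverse>"
      by simp
  next
    fix X Y :: "'b set" and r g f
    assume "(g, f) \<in> (exp_ext A \<A> X Y r)\<inverse>"
    then show "(g, f) \<in> exp_ext A \<A> Y X (r\<inverse>)"
      by (simp add: swap)
  qed
qed

text \<open>Normality of the witnesses gives the inclusion into the identity; the reverse inclusion
  needs only the unit as witness.\<close>

lemma normal_ext_exp_ext:
  assumes sub: "\<A> \<subseteq> Pow (A \<times> A)" and unit: "Id_on A \<in> \<A>"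
    and normal: "\<And>\<phi>. \<phi> \<in> \<A> \<Longrightarrow> normal_endorel A \<phi>"
  shows "normal_ext (exp_ob A) (exp_ext A \<A>)"
proof -
  have "exp_ext A \<A> X X (Id_on X) = Id_on (exp_ob A X)" for X :: "'b set"
  proof (intro equalityI subrelI)
    fix f g assume "(f, g) \<in> exp_ext A \<A> X X (Id_on X)"
    then obtain \<phi> where fg: "f \<in> A \<rightarrow>\<^sub>E X" "g \<in> A \<rightarrow>\<^sub>E X"
      and \<phi>: "\<phi> \<in> \<A>" "\<forall>(a, b)\<in>\<phi>. (f a, g b) \<in> Id_on X"
      by (auto simp: mem_exp_ext[OF sub])
    \<comment> \<open>This is a competitor for the difunctional closure of \<phi>. It is
      difunctional although its intermediate set is \<open>X\<close>, of an unrelated type: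
      \<open>difunctionalI\<close> permits any codomain.\<close>
    let ?d = "(graph A g)\<inverse> \<cdot> graph A f"
    have "\<phi> \<subseteq> A \<times> A"
      using sub \<phi>(1) by blast
    moreover have "\<phi> \<subseteq> ?d"
    proof (rule subrelI)
      fix a b assume "(a, b) \<in> \<phi>"
      then show "(a, b) \<in> ?d"
        using \<phi>(2) \<open>\<phi> \<subseteq> A \<times> A\<close> by (fastforce simp only: mem_graph_converse_comp Id_on_iff)
    qed
    ultimately have "difunctional_closure A A \<phi> \<subseteq> ?d"
      by (intro difunctional_closure_least(3) difunctionalI)
    moreover have "refl_on A (difunctional_closure A A \<phi>)"
      using normal[OF \<phi>(1)] by (simp add: normal_endorel_def)
    \<comment> \<open>Reflexivity puts \<open>(a, a)\<close> into the closure and hence into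
      \<open>?d\<close>, which says exactly this.\<close>
    ultimately have "f a = g a" if "a \<in> A" for a
      using that by (auto dest!: refl_onD simp: BNF_Def.Gr_def)
    then have "f = g"
      using fg by (intro PiE_ext)
    then show "(f, g) \<in> Id_on (exp_ob A X)"
      using fg by (auto simp: exp_ob_def)
  next
    fix f g assume "(f, g) \<in> Id_on (exp_ob A X)"
    then show "(f, g) \<in> exp_ext A \<A> X X (Id_on X)"
      using unit by (auto simp: mem_exp_ext[OF sub] exp_ob_def intro!: bexI[of _ "Id_on A"])
  qed
  then show ?thesis
    by (simp add: normal_ext_def)
qed

theorem theorem32:
  fixes A :: "'a set" and \<A> :: "('a \<times> 'a) set set"
  assumes "submonoid \<A> (endorel_monoid A)"
  shows "lax_extension (exp_ob A :: 'u set \<Rightarrow> ('a \<Rightarrow> 'u) set) (exp_mor A) (exp_ext A \<A>) \<and>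
    ((\<forall>\<phi>\<in>\<A>. \<phi>\<inverse> \<in> \<A>) \<longrightarrow>
      preserves_converses (exp_ext A \<A> ::
        'u set \<Rightarrow> 'u set \<Rightarrow> ('u \<times> 'u) set \<Rightarrow> (('a \<Rightarrow> 'u) \<times> ('a \<Rightarrow> 'u)) set)) \<and>
    ((\<forall>\<phi>\<in>\<A>. normal_endorel A \<phi>) \<longrightarrow>
      normal_ext (exp_ob A :: 'u set \<Rightarrow> ('a \<Rightarrow> 'u) set) (exp_ext A \<A>))"
proof -
  have "\<A> \<subseteq> Pow (A \<times> A)" "Id_on A \<in> \<A>"
    using assms by (auto simp: submonoid_def endorel_monoid_def)
  then show ?thesis
    using lax_extension_exp_ext[OF assms] preserves_converses_exp_ext[of \<A> A]
      normal_ext_exp_ext[of \<A> A]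
    by auto
qed

end
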